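(* Let $E$ be a Banach lattice with the positive Schur property, and let $T:E\to E$ be an operator. Then $T$ is uo-demi Dunford–Pettis if and only if $T$ is un-demi Dunford–Pettis.
   Context: All Banach lattices are real; "operator" means bounded linear map. A Banach lattice $E$ has the positive Schur property if every weakly null sequence with positive terms in $E$ is norm null. A net $(x_\alpha)$ in a Banach lattice $E$ is uo-convergent (unbounded order convergent) to $x$ if $|x_\alpha-x|\wedge y$ converges in order to $0$ for every $y\in E^+$, and un-convergent (unbounded norm convergent) to $x$ if $\||x_\alpha-x|\wedge y\|\to0$ for every $y\in E^+$. An operator $T:E\to E$ on a Banach lattice $E$ is uo-demi Dunford–Pettis (unbounded order demi Dunford–Pettis) if for every weakly null sequence $(x_n)$ in $E$ such that $(x_n-T(x_n))$ is uo-convergent to $0$, one has $\|x_n\|\to0$. It is un-demi Dunford–Pettis if for every weakly null sequence $(x_n)$ in $E$ such that $(x_n-T(x_n))$ un-converges to $0$, the sequence $(x_n)$ un-converges to $0$. *)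

theory Defs
  imports "HOL-Analysis.Analysis" "HOL-Library.Lattice_Algebras"
begin

text \<open>
  Banach lattices. The ordered vector space and lattice structure come from
  \<^class>\<open>ordered_real_vector\<close> and \<^class>\<open>lattice_ab_group_add_abs\<close>; the latter contains
  the axiom \<open>\<bar>x\<bar> = sup x (- x)\<close>.
\<close>

class banach_lattice = banach + ordered_real_vector + lattice_ab_group_add_abs +
  assumes norm_mono_abs: "\<bar>x\<bar> \<le> \<bar>y\<bar> \<Longrightarrow> norm x \<le> norm y"

definition weakly_null :: "(nat \<Rightarrow> 'a::real_normed_vector) \<Rightarrow> bool" where
  "weakly_null x \<longleftrightarrow>
     (\<forall>f :: 'a \<Rightarrow> real. bounded_linear f \<longrightarrow> (\<lambda>n. f (x n)) \<longlonglongrightarrow> 0)"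

text \<open>A property of the space \<open>'a\<close> itself, hence the type argument.\<close>

definition positive_schur :: "'a::banach_lattice itself \<Rightarrow> bool" where
  "positive_schur _ \<longleftrightarrow>
     (\<forall>x :: nat \<Rightarrow> 'a. (\<forall>n. 0 \<le> x n) \<and> weakly_null x \<longrightarrow> (\<lambda>n. norm (x n)) \<longlonglongrightarrow> 0)"

text \<open>
  Convergence of nets is expressed by filters on the index type: \<open>\<forall>\<^sub>F\<close> means
  ``for all sufficiently large indices'', and sequences are the case \<^const>\<open>sequentially\<close>.

  \<open>x \<rightarrow> l\<close> in order iff there is a net \<open>y\<close> with \<open>y \<down> 0\<close>, possibly over another
  index set, each of whose terms eventually dominates \<open>\<bar>x - l\<bar>\<close>. Only the set \<open>D\<close>
  of terms of \<open>y\<close> matters: it is nonempty, directed downwards and has infimum \<open>0\<close>;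
  conversely, such a set is a decreasing net indexed by itself.
\<close>

definition decreasing_to_zero :: "'a::banach_lattice set \<Rightarrow> bool" where
  "decreasing_to_zero D \<longleftrightarrow>
     D \<noteq> {} \<and>
     (\<forall>a\<in>D. \<forall>b\<in>D. \<exists>c\<in>D. c \<le> a \<and> c \<le> b) \<and>
     (\<forall>d\<in>D. 0 \<le> d) \<and> (\<forall>z. (\<forall>d\<in>D. z \<le> d) \<longrightarrow> z \<le> 0)"

definition order_convergent :: "('i \<Rightarrow> 'a::banach_lattice) \<Rightarrow> 'a \<Rightarrow> 'i filter \<Rightarrow> bool" where
  "order_convergent x l F \<longleftrightarrow>
     (\<exists>D. decreasing_to_zero D \<and> (\<forall>d\<in>D. \<forall>\<^sub>F i in F. \<bar>x i - l\<bar> \<le> d))"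

definition uo_convergent :: "('i \<Rightarrow> 'a::banach_lattice) \<Rightarrow> 'a \<Rightarrow> 'i filter \<Rightarrow> bool" where
  "uo_convergent x l F \<longleftrightarrow>
     (\<forall>y. 0 \<le> y \<longrightarrow> order_convergent (\<lambda>i. inf \<bar>x i - l\<bar> y) 0 F)"

definition un_convergent :: "('i \<Rightarrow> 'a::banach_lattice) \<Rightarrow> 'a \<Rightarrow> 'i filter \<Rightarrow> bool" where
  "un_convergent x l F \<longleftrightarrow>
     (\<forall>y. 0 \<le> y \<longrightarrow> ((\<lambda>i. norm (inf \<bar>x i - l\<bar> y)) \<longlongrightarrow> 0) F)"

definition uo_demi_Dunford_Pettis :: "('a::banach_lattice \<Rightarrow> 'a) \<Rightarrow> bool" where
  "uo_demi_Dunford_Pettis T \<longleftrightarrow>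
     (\<forall>x. weakly_null x \<and> uo_convergent (\<lambda>n. x n - T (x n)) 0 sequentially
        \<longrightarrow> (\<lambda>n. norm (x n)) \<longlonglongrightarrow> 0)"

definition un_demi_Dunford_Pettis :: "('a::banach_lattice \<Rightarrow> 'a) \<Rightarrow> bool" where
  "un_demi_Dunford_Pettis T \<longleftrightarrow>
     (\<forall>x. weakly_null x \<and> un_convergent (\<lambda>n. x n - T (x n)) 0 sequentially
        \<longrightarrow> un_convergent x 0 sequentially)"

end

theory Submission
  imports Defs
begin

text \<open>
  A sequence of positive vectors whose partial sums are order bounded is weakly null. Under the
  positive Schur property the increments of a monotone order bounded sequence are therefore norm
  null, so the norm is order continuous and uo-null implies un-null.

  An un-null sequence has a subsequence \<open>u\<close> that is almost disjoint: the vectors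
  \<open>inf \<bar>u k\<bar> (\<Sum>j<k. \<bar>u j\<bar>)\<close> have summable norms. Then \<open>\<Sum>k. inf \<bar>u k\<bar> y\<close>
  has order bounded partial sums for each \<open>y \<ge> 0\<close>, so it converges in norm and its
  tails show that \<open>u\<close> is uo-null. This settles the implication from uo to un.

  For the converse, a weakly null and un-null sequence must be shown to be norm null. Otherwise
  the moduli of some subsequence are not weakly null, so a functional is bounded away from zero
  on the moduli of an almost disjoint subsequence. For almost disjoint vectors the modulus of a
  positive combination is close to the combination of the moduli, so the convex combinations of
  this subsequence stay away from zero in norm, which by Hahn--Banach contradicts weak nullity.
\<close>

section \<open>Banach lattices\<close>

lemma norm_mono_nonneg:
  fixes a b :: "'a::banach_lattice"
  assumes "0 \<le> a" "a \<le> b"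
  shows "norm a \<le> norm b"
  using assms by (intro norm_mono_abs) (simp add: abs_of_nonneg)

lemma norm_abs_eq [simp]: "norm \<bar>x\<bar> = norm (x::'a::banach_lattice)"
  by (intro antisym norm_mono_abs) simp_all

lemma abs_scaleR_nonneg:
  fixes x :: "'a::banach_lattice"
  assumes "0 \<le> c"
  shows "\<bar>c *\<^sub>R x\<bar> = c *\<^sub>R \<bar>x\<bar>"
proof (cases "c = 0")
  case False
  with assms have c: "c > 0" by simp
  have le: "\<bar>c *\<^sub>R z\<bar> \<le> c *\<^sub>R \<bar>z\<bar>" if "c > 0" for c and z :: 'a
    using that by (intro abs_leI)
      (auto simp: scaleR_minus_right [symmetric] abs_ge_self abs_ge_minus_self
        simp del: scaleR_minus_right intro!: scaleR_left_mono)
  \<comment> \<open>The inequality \<open>le\<close> for the scalar \<open>inverse c\<close> at the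
    vector \<open>c *\<^sub>R x\<close> is the reverse inequality after multiplication by
    \<open>c\<close>.\<close>
  have "\<bar>inverse c *\<^sub>R (c *\<^sub>R x)\<bar> \<le> inverse c *\<^sub>R \<bar>c *\<^sub>R x\<bar>"
    using c by (intro le) simp
  then have "c *\<^sub>R \<bar>x\<bar> \<le> c *\<^sub>R (inverse c *\<^sub>R \<bar>c *\<^sub>R x\<bar>)"
    using c by (intro scaleR_left_mono) auto
  with c le [OF c, of x] show ?thesis by (intro antisym) auto
qed simp

lemma inf_scaleR:
  fixes u v :: "'a::banach_lattice"
  assumes "0 \<le> c"
  shows "inf (c *\<^sub>R u) (c *\<^sub>R v) = c *\<^sub>R inf u v"
proof (cases "c = 0")
  case False
  with assms have c: "c > 0" by simp
  have "inverse c *\<^sub>R inf (c *\<^sub>R u) (c *\<^sub>R v) \<le> inf u v"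
    using c scaleR_left_mono [of "inf (c *\<^sub>R u) (c *\<^sub>R v)" "c *\<^sub>R u" "inverse c"]
      scaleR_left_mono [of "inf (c *\<^sub>R u) (c *\<^sub>R v)" "c *\<^sub>R v" "inverse c"]
    by simp
  then have "c *\<^sub>R (inverse c *\<^sub>R inf (c *\<^sub>R u) (c *\<^sub>R v)) \<le> c *\<^sub>R inf u v"
    using c by (intro scaleR_left_mono) auto
  with c show ?thesis
    by (intro antisym) (auto intro!: scaleR_left_mono)
qed simp

text \<open>Since sup and inf of two vectors add up to their sum, the left side is the difference of
  sup and inf of the moduli, and the triangle inequality bounds it. Vectors with small overlap thus
  have almost additive moduli.\<close>

lemma abs_add_ge_minus_inf:
  fixes a b :: "'a::banach_lattice"
  shows "\<bar>a\<bar> + \<bar>b\<bar> - 2 *\<^sub>R inf \<bar>a\<bar> \<bar>b\<bar> \<le> \<bar>a + b\<bar>"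
proof -
  have "\<bar>a\<bar> + \<bar>b\<bar> - 2 *\<^sub>R inf \<bar>a\<bar> \<bar>b\<bar> = sup \<bar>a\<bar> \<bar>b\<bar> - inf \<bar>a\<bar> \<bar>b\<bar>"
    using add_eq_inf_sup [of "\<bar>a\<bar>" "\<bar>b\<bar>"] by (simp add: algebra_simps scaleR_2)
  also have "\<dots> \<le> \<bar>a + b\<bar>"
  proof -
    have 1: "\<bar>a\<bar> \<le> \<bar>a + b\<bar> + \<bar>b\<bar>" using abs_triangle_ineq [of "a + b" "- b"] by simp
    have 2: "\<bar>b\<bar> \<le> \<bar>a + b\<bar> + \<bar>a\<bar>" using abs_triangle_ineq [of "a + b" "- a"] by simp
    have "sup \<bar>a\<bar> \<bar>b\<bar> \<le> inf (\<bar>a + b\<bar> + \<bar>a\<bar>) (\<bar>a + b\<bar> + \<bar>b\<bar>)"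
      using 1 2 by simp
    also have "\<dots> = \<bar>a + b\<bar> + inf \<bar>a\<bar> \<bar>b\<bar>"
      by (simp add: add_inf_distrib_left)
    finally show ?thesis unfolding diff_le_eq .
  qed
  finally show ?thesis .
qed

text \<open>The positive cone is norm closed: as \<open>s n\<close> is positive, the negative part
  of \<open>l\<close> lies below \<open>\<bar>s n - l\<bar>\<close>, so its norm is 0.\<close>

lemma nonneg_LIMSEQ:
  fixes s :: "nat \<Rightarrow> 'a::banach_lattice"
  assumes lim: "s \<longlonglongrightarrow> l" and pos: "\<And>n. 0 \<le> s n"
  shows "0 \<le> l"
proof -
  have "norm (sup (- l) 0) \<le> norm (s n - l)" for n
  proof -
    have "sup (- l) 0 \<le> \<bar>s n - l\<bar>"
    proof (rule sup_least)
      have "- l \<le> s n - l" using pos [of n] by simp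
      also have "\<dots> \<le> \<bar>s n - l\<bar>" by (rule abs_ge_self)
      finally show "- l \<le> \<bar>s n - l\<bar>" .
    qed simp
    then have "norm (sup (- l) 0) \<le> norm \<bar>s n - l\<bar>"
      by (intro norm_mono_nonneg) simp_all
    then show ?thesis by simp
  qed
  moreover have "(\<lambda>n. norm (s n - l)) \<longlonglongrightarrow> 0"
    using lim by (simp add: tendsto_norm_zero LIM_zero)
  ultimately have "norm (sup (- l) 0) \<le> 0"
    by (meson LIMSEQ_le_const)
  then have "sup (- l) 0 = 0" by simp
  then have "- l \<le> 0" by (metis sup_ge1)
  then show ?thesis by simp
qed

lemma LIMSEQ_le_const_lattice:
  fixes s :: "nat \<Rightarrow> 'a::banach_lattice"
  assumes "s \<longlonglongrightarrow> l" and "\<And>n. s n \<le> b"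
  shows "l \<le> b"
proof -
  have "(\<lambda>n. b - s n) \<longlonglongrightarrow> b - l" by (intro tendsto_intros assms)
  then have "0 \<le> b - l" by (rule nonneg_LIMSEQ) (simp add: assms)
  then show ?thesis by simp
qed

lemma sum_le_suminf_lattice:
  fixes e :: "nat \<Rightarrow> 'a::banach_lattice"
  assumes "summable e" and pos: "\<And>n. 0 \<le> e n"
  shows "(\<Sum>k<n. e k) \<le> suminf e"
proof -
  have "(\<lambda>m. (\<Sum>k<m+n. e k) - (\<Sum>k<n. e k)) \<longlonglongrightarrow> suminf e - (\<Sum>k<n. e k)"
    using summable_LIMSEQ [OF assms(1)] LIMSEQ_ignore_initial_segment
    by (intro tendsto_intros) blast
  moreover have "0 \<le> (\<Sum>k<m+n. e k) - (\<Sum>k<n. e k)" for m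
    using pos by (simp add: sum_mono2)
  ultimately have "0 \<le> suminf e - (\<Sum>k<n. e k)" by (rule nonneg_LIMSEQ)
  then show ?thesis by simp
qed

section \<open>The positive Schur property and order continuity\<close>

text \<open>Attaching the sign of \<open>f (e n)\<close> to \<open>e n\<close> turns the sum of the
  \<open>\<bar>f (e n)\<bar>\<close> into \<open>f\<close> of one vector with modulus at most
  \<open>y\<close>. The values of \<open>f\<close> are therefore absolutely summable.\<close>

lemma weakly_null_if_order_bounded_sums:
  fixes e :: "nat \<Rightarrow> 'a::banach_lattice"
  assumes pos: "\<And>n. 0 \<le> e n" and bd: "\<And>N. (\<Sum>n<N. e n) \<le> y"
  shows "weakly_null e"
  unfolding weakly_null_def
proof (intro allI impI)
  fix f :: "'a \<Rightarrow> real"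
  assume f: "bounded_linear f"
  then obtain K where K: "K > 0" "\<And>x. norm (f x) \<le> norm x * K"
    using bounded_linear.pos_bounded by blast
  have "(\<Sum>n<N. \<bar>f (e n)\<bar>) \<le> norm y * K" for N
  proof -
    define s where "s n = sgn (f (e n)) *\<^sub>R e n" for n
    have s: "\<bar>s n\<bar> \<le> e n" for n
      using pos [of n] by (auto simp: s_def sgn_real_def abs_of_nonneg)
    have lin: "linear f" using f by (rule bounded_linear.linear)
    have "f (s n) = \<bar>f (e n)\<bar>" for n
      unfolding s_def linear_cmul [OF lin] by (simp add: abs_sgn mult.commute)
    then have "(\<Sum>n<N. \<bar>f (e n)\<bar>) = f (\<Sum>n<N. s n)"
      unfolding linear_sum [OF lin] by simp
    also have "\<dots> \<le> norm (\<Sum>n<N. s n) * K" using K(2) [of "\<Sum>n<N. s n"] by auto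
    also have "\<dots> \<le> norm y * K"
    proof (intro mult_right_mono norm_mono_abs)
      have "\<bar>\<Sum>n<N. s n\<bar> \<le> (\<Sum>n<N. \<bar>s n\<bar>)" by (rule sum_abs)
      also have "\<dots> \<le> (\<Sum>n<N. e n)" by (intro sum_mono s)
      also have "\<dots> \<le> y" by (rule bd)
      also have "\<dots> \<le> \<bar>y\<bar>" by (rule abs_ge_self)
      finally show "\<bar>\<Sum>n<N. s n\<bar> \<le> \<bar>y\<bar>" .
    qed (use K in simp)
    finally show ?thesis .
  qed
  then have "summable (\<lambda>n. \<bar>f (e n)\<bar>)"
    by (intro summableI_nonneg_bounded) auto
  then show "(\<lambda>n. f (e n)) \<longlonglongrightarrow> 0"
    by (rule tendsto_rabs_zero_cancel [OF summable_LIMSEQ_zero])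
qed

text \<open>Otherwise one could descend forever in steps of norm at least \<epsilon>. The steps
  telescope, so their sums stay below \<open>a 0 - z\<close>; they are weakly null, hence norm null
  by the positive Schur property.\<close>

lemma positive_schur_almost_minimal:
  fixes D :: "'a::banach_lattice set"
  assumes psp: "positive_schur TYPE('a)"
    and ne: "D \<noteq> {}" and lower: "\<And>d. d \<in> D \<Longrightarrow> z \<le> d" and "\<epsilon> > 0"
  shows "\<exists>d\<in>D. \<forall>d'\<in>D. d' \<le> d \<longrightarrow> norm (d - d') < \<epsilon>"
proof (rule ccontr)
  assume "\<not> ?thesis"
  then have step: "\<exists>d'\<in>D. d' \<le> d \<and> \<epsilon> \<le> norm (d - d')" if "d \<in> D" for d
    using that by (meson not_le)
  obtain a where a: "\<And>n. a n \<in> D" "\<And>n. a (Suc n) \<le> a n"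
    "\<And>n. \<epsilon> \<le> norm (a n - a (Suc n))"
    using dependent_nat_choice [of "\<lambda>_ d. d \<in> D" "\<lambda>_ d d'. d' \<le> d \<and> \<epsilon> \<le> norm (d - d')"]
      step ne by blast
  define e where "e n = a n - a (Suc n)" for n
  have "(\<Sum>n<N. e n) = a 0 - a N" for N
    by (induction N) (auto simp: e_def)
  then have bd: "(\<Sum>n<N. e n) \<le> a 0 - z" for N
    using lower [OF a(1), of N] by simp
  have pos: "0 \<le> e n" for n using a(2) by (simp add: e_def)
  have "(\<lambda>n. norm (e n)) \<longlonglongrightarrow> 0"
    using psp pos weakly_null_if_order_bounded_sums [OF pos bd]
    unfolding positive_schur_def by blast
  then have "\<epsilon> \<le> 0" using a(3) by (intro LIMSEQ_le_const) (auto simp: e_def)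
  with \<open>\<epsilon> > 0\<close> show False by simp
qed

text \<open>The remainders \<open>y - (\<Sum>n<N. e n)\<close> decrease and are bounded below by 0.
  Beyond an almost minimal remainder all others are close to it in norm, which is the Cauchy
  criterion.\<close>

lemma positive_schur_summable:
  fixes e :: "nat \<Rightarrow> 'a::banach_lattice"
  assumes psp: "positive_schur TYPE('a)"
    and pos: "\<And>n. 0 \<le> e n" and bd: "\<And>N. (\<Sum>n<N. e n) \<le> y"
  shows "summable e"
  unfolding summable_Cauchy
proof (intro allI impI)
  fix \<epsilon> :: real assume "\<epsilon> > 0"
  define a where "a N = y - (\<Sum>n<N. e n)" for N
  have "\<exists>d\<in>range a. \<forall>d'\<in>range a. d' \<le> d \<longrightarrow> norm (d - d') < \<epsilon> / 2"
    using \<open>\<epsilon> > 0\<close> bd by (intro positive_schur_almost_minimal [OF psp, where z = 0]) (auto simp: a_def)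
  then obtain N where N: "\<And>n. a n \<le> a N \<Longrightarrow> norm (a N - a n) < \<epsilon> / 2" by auto
  have N': "norm (a N - a n) < \<epsilon> / 2" if "n \<ge> N" for n
    using that pos by (intro N) (auto simp: a_def intro!: sum_mono2)
  have "norm (sum e {m..<n}) < \<epsilon>" if "m \<ge> N" for m n
  proof (cases "m \<le> n")
    case True
    have "sum e {m..<n} = (a N - a n) - (a N - a m)"
      using sum_diff_nat_ivl [of 0 m n e] True by (simp add: a_def atLeast0LessThan)
    also have "norm \<dots> < \<epsilon>"
      using N' [of m] N' [of n] that True norm_triangle_ineq4 [of "a N - a n" "a N - a m"] by simp
    finally show ?thesis .
  qed (use \<open>\<epsilon> > 0\<close> in simp)
  then show "\<exists>N. \<forall>m\<ge>N. \<forall>n. norm (sum e {m..<n}) < \<epsilon>" by blast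
qed

text \<open>Choose \<open>a n\<close> in \<open>D\<close> minimal up to \<open>1 / (n + 1)\<close>.
  Any two of them are close to a common lower bound in \<open>D\<close>, so they form a Cauchy
  sequence; its limit turns out to be a lower bound of \<open>D\<close> and must be 0.\<close>

lemma positive_schur_order_continuous:
  fixes D :: "'a::banach_lattice set"
  assumes psp: "positive_schur TYPE('a)" and D: "decreasing_to_zero D" and "\<epsilon> > 0"
  shows "\<exists>d\<in>D. norm d < \<epsilon>"
proof -
  have ne: "D \<noteq> {}" and dir: "\<And>a b. a \<in> D \<Longrightarrow> b \<in> D \<Longrightarrow> \<exists>c\<in>D. c \<le> a \<and> c \<le> b"
    and pos: "\<And>d. d \<in> D \<Longrightarrow> 0 \<le> d" and inf0: "\<And>z. (\<And>d. d \<in> D \<Longrightarrow> z \<le> d) \<Longrightarrow> z \<le> 0"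
    using D unfolding decreasing_to_zero_def by auto
  have "\<exists>d\<in>D. \<forall>d'\<in>D. d' \<le> d \<longrightarrow> norm (d - d') < inverse (real (Suc n))" for n
    by (intro positive_schur_almost_minimal [OF psp ne pos]) auto
  then obtain a where a: "\<And>n. a n \<in> D"
    "\<And>n d'. d' \<in> D \<Longrightarrow> d' \<le> a n \<Longrightarrow> norm (a n - d') < inverse (real (Suc n))"
    by metis
  have "Cauchy a"
  proof (rule metric_CauchyI)
    fix \<delta> :: real assume "\<delta> > 0"
    then obtain N where N: "inverse (real (Suc N)) < \<delta> / 2"
      using reals_Archimedean [of "\<delta> / 2"] by auto
    have "dist (a m) (a n) < \<delta>" if "m \<ge> N" "n \<ge> N" for m n
    proof -
      obtain c where c: "c \<in> D" "c \<le> a m" "c \<le> a n" using dir a(1) by blast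
      have "inverse (real (Suc m)) \<le> inverse (real (Suc N))"
           "inverse (real (Suc n)) \<le> inverse (real (Suc N))"
        using that by (auto intro!: le_imp_inverse_le)
      with a(2) [OF c(1,2)] a(2) [OF c(1,3)] N
      have "norm (a m - c) < \<delta> / 2" "norm (a n - c) < \<delta> / 2" by linarith+
      then show ?thesis
        using norm_triangle_ineq4 [of "a m - c" "a n - c"] by (simp add: dist_norm)
    qed
    then show "\<exists>M. \<forall>m\<ge>M. \<forall>n\<ge>M. dist (a m) (a n) < \<delta>" by blast
  qed
  then obtain l where l: "a \<longlonglongrightarrow> l" using Cauchy_convergent convergent_def by blast
  have "l \<le> d" if d: "d \<in> D" for d
  proof -
    \<comment> \<open>The limit is compared with \<open>d\<close> through elements below both
      \<open>d\<close> and \<open>a n\<close>: almost minimality forces them to the same limit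
      \<open>l\<close>.\<close>
    have "\<exists>c\<in>D. c \<le> d \<and> c \<le> a n" for n using dir a(1) d by blast
    then obtain c where c: "\<And>n. c n \<in> D" "\<And>n. c n \<le> d" "\<And>n. c n \<le> a n" by metis
    have "(\<lambda>n. a n - c n) \<longlonglongrightarrow> 0"
      by (rule Lim_null_comparison [OF _ LIMSEQ_inverse_real_of_nat])
        (use a(2) c in \<open>auto intro!: always_eventually less_imp_le\<close>)
    from tendsto_diff [OF l this] have "c \<longlonglongrightarrow> l" by simp
    then show ?thesis using c(2) by (rule LIMSEQ_le_const_lattice)
  qed
  then have "l \<le> 0" by (rule inf0)
  moreover have "0 \<le> l" using nonneg_LIMSEQ [OF l] pos a(1) by blast
  ultimately have "l = 0" by simp
  with l have "\<forall>\<^sub>F n in sequentially. norm (a n) < \<epsilon>"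
    using \<open>\<epsilon> > 0\<close> by (simp add: tendsto_iff)
  then obtain n where "norm (a n) < \<epsilon>" by (auto dest: eventually_happens)
  with a(1) show ?thesis by blast
qed

lemma uo_convergent_imp_un_convergent:
  fixes x :: "'i \<Rightarrow> 'a::banach_lattice"
  assumes psp: "positive_schur TYPE('a)" and uo: "uo_convergent x l F"
  shows "un_convergent x l F"
  unfolding un_convergent_def
proof (intro allI impI)
  fix y :: 'a assume "0 \<le> y"
  then obtain D where D: "decreasing_to_zero D"
    and dom: "\<And>d. d \<in> D \<Longrightarrow> \<forall>\<^sub>F i in F. \<bar>inf \<bar>x i - l\<bar> y\<bar> \<le> d"
    using uo unfolding uo_convergent_def order_convergent_def by fastforce
  show "((\<lambda>i. norm (inf \<bar>x i - l\<bar> y)) \<longlongrightarrow> 0) F"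
  proof (rule tendstoI)
    fix \<epsilon> :: real assume "\<epsilon> > 0"
    then obtain d where d: "d \<in> D" "norm d < \<epsilon>"
      using positive_schur_order_continuous [OF psp D] by blast
    show "\<forall>\<^sub>F i in F. dist (norm (inf \<bar>x i - l\<bar> y)) 0 < \<epsilon>"
      using dom [OF d(1)]
    proof eventually_elim
      case (elim i)
      then have "norm (inf \<bar>x i - l\<bar> y) \<le> norm d"
        by (intro norm_mono_abs) (meson abs_ge_self order_trans)
      with d(2) show ?case by simp
    qed
  qed
qed

section \<open>Almost disjoint subsequences\<close>

text \<open>At each stage the sum of the moduli chosen so far is one fixed positive vector, and
  un-convergence makes the overlap of late terms with it as small as desired.\<close>

lemma un_null_almost_disjoint_subseq:
  fixes x :: "nat \<Rightarrow> 'a::banach_lattice" and \<eta> :: "nat \<Rightarrow> real"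
  assumes un: "un_convergent x 0 sequentially" and \<eta>: "\<And>k. \<eta> k > 0"
  obtains r where "strict_mono r"
    "\<And>k. norm (inf \<bar>x (r k)\<bar> (\<Sum>j<k. \<bar>x (r j)\<bar>)) < \<eta> k"
proof -
  have ex: "\<exists>m>n. norm (inf \<bar>x m\<bar> y) < \<epsilon>" if "0 \<le> y" "\<epsilon> > 0" for n y and \<epsilon> :: real
  proof -
    have "(\<lambda>i. norm (inf \<bar>x i\<bar> y)) \<longlonglongrightarrow> 0"
      using un that(1) unfolding un_convergent_def by auto
    with that(2) have "\<forall>\<^sub>F i in sequentially. norm (inf \<bar>x i\<bar> y) < \<epsilon>"
      by (auto dest: order_tendstoD)
    then have "\<forall>\<^sub>F i in sequentially. norm (inf \<bar>x i\<bar> y) < \<epsilon> \<and> i > n"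
      using eventually_gt_at_top by (rule eventually_conj)
    then show ?thesis by (auto dest: eventually_happens)
  qed
  \<comment> \<open>The state carries the sum of all earlier \<open>\<bar>x (r j)\<bar>\<close> along with the index.\<close>
  have "\<exists>f :: nat \<Rightarrow> nat \<times> 'a. \<forall>k. (0 \<le> snd (f k) \<and> norm (inf \<bar>x (fst (f k))\<bar> (snd (f k))) < \<eta> k
            \<and> (k = 0 \<longrightarrow> snd (f k) = 0))
        \<and> (fst (f k) < fst (f (Suc k)) \<and> snd (f (Suc k)) = snd (f k) + \<bar>x (fst (f k))\<bar>)"
    (is "\<exists>f. \<forall>k. ?P k (f k) \<and> ?Q k (f k) (f (Suc k))")
  proof (rule dependent_nat_choice)
    show "\<exists>p. ?P 0 p" using ex [of 0 "\<eta> 0" 0] \<eta> by auto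
  next
    fix p k assume "?P k p"
    then have "0 \<le> snd p + \<bar>x (fst p)\<bar>" by simp
    from ex [OF this \<eta>, of "fst p" "Suc k"] \<open>?P k p\<close>
    show "\<exists>q. ?P (Suc k) q \<and> ?Q k p q" by auto
  qed
  then obtain f where f: "\<And>k. ?P k (f k)" "\<And>k. ?Q k (f k) (f (Suc k))" by blast
  have "snd (f k) = (\<Sum>j<k. \<bar>x (fst (f j))\<bar>)" for k
    by (induction k) (use f in auto)
  with f show ?thesis
    by (intro that [of "\<lambda>k. fst (f k)"]) (auto simp: strict_mono_Suc_iff)
qed

text \<open>The tails of the series serve as the decreasing net: the tail from \<open>m\<close> on
  dominates every \<open>p n\<close> with \<open>n \<ge> m\<close>, and the tails tend to 0 in
  norm.\<close>

lemma order_convergent_zero_if_summable: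
  fixes p :: "nat \<Rightarrow> 'a::banach_lattice"
  assumes sm: "summable p" and pos: "\<And>n. 0 \<le> p n"
  shows "order_convergent p 0 sequentially"
proof -
  define d where "d m = suminf p - (\<Sum>k<m. p k)" for m
  have dm: "d n \<le> d m" if "m \<le> n" for m n
    using that pos by (auto simp: d_def intro!: sum_mono2)
  have d0: "d \<longlonglongrightarrow> 0"
    unfolding d_def using tendsto_diff [OF tendsto_const summable_LIMSEQ [OF sm], of "suminf p"] by simp
  have "decreasing_to_zero (range d)"
    unfolding decreasing_to_zero_def
  proof (intro conjI ballI allI impI)
    show "\<exists>c\<in>range d. c \<le> a \<and> c \<le> b" if "a \<in> range d" "b \<in> range d" for a b
    proof -
      from that obtain m n where "a = d m" "b = d n" by blast
      then show ?thesis using dm [of m "max m n"] dm [of n "max m n"] by auto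
    qed
    show "0 \<le> a" if "a \<in> range d" for a
      using that sum_le_suminf_lattice [OF sm pos] by (auto simp: d_def)
    show "z \<le> 0" if "\<forall>a\<in>range d. z \<le> a" for z
      using nonneg_LIMSEQ [of "\<lambda>n. d n - z" "0 - z"] tendsto_diff [OF d0 tendsto_const] that by auto
  qed auto
  moreover have "\<forall>\<^sub>F n in sequentially. \<bar>p n - 0\<bar> \<le> a" if a: "a \<in> range d" for a
  proof -
    from a obtain m where m: "a = d m" by blast
    have "p n \<le> d m" if "m \<le> n" for n
    proof -
      have "p n + (\<Sum>k<m. p k) \<le> (\<Sum>k<Suc n. p k)"
        using that pos by (auto simp: add.commute intro!: add_left_mono sum_mono2)
      also have "\<dots> \<le> suminf p" by (rule sum_le_suminf_lattice [OF sm pos])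
      finally show ?thesis by (simp add: d_def le_diff_eq)
    qed
    then show ?thesis
      using pos m by (auto simp: abs_of_nonneg eventually_sequentially)
  qed
  ultimately show ?thesis unfolding order_convergent_def by blast
qed

lemma almost_disjoint_imp_uo_null:
  fixes u :: "nat \<Rightarrow> 'a::banach_lattice"
  assumes psp: "positive_schur TYPE('a)"
    and sm: "summable (\<lambda>k. norm (inf \<bar>u k\<bar> (\<Sum>j<k. \<bar>u j\<bar>)))"
  shows "uo_convergent u 0 sequentially"
  unfolding uo_convergent_def
proof (intro allI impI)
  fix y :: 'a assume y: "0 \<le> y"
  define w where "w k = inf \<bar>u k\<bar> (\<Sum>j<k. \<bar>u j\<bar>)" for k
  define p where "p k = inf \<bar>u k\<bar> y" for k
  have w: "summable w" "0 \<le> w k" for k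
    using summable_norm_cancel [OF sm] by (simp_all add: w_def [abs_def] sum_nonneg)
  have p: "0 \<le> p k" for k using y by (simp add: p_def)
  \<comment> \<open>The \<open>p k\<close> are below \<open>y\<close>; were they disjoint, their sum would be their supremum.\<close>
  have "(\<Sum>k<N. p k) \<le> y + (\<Sum>k<N. w k)" for N
  proof (induction N)
    case (Suc N)
    \<comment> \<open>The supremum is at most the old bound because both arguments are; the infimum
      is the overlap of \<open>p N\<close> with its predecessors, which \<open>w N\<close>
      controls.\<close>
    have "(\<Sum>k<Suc N. p k) = sup (\<Sum>k<N. p k) (p N) + inf (\<Sum>k<N. p k) (p N)"
      by (simp add: add_eq_inf_sup [symmetric])
    also have "\<dots> \<le> (y + (\<Sum>k<N. w k)) + w N"
    proof (rule add_mono)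
      have "p N \<le> y" by (simp add: p_def)
      also have "\<dots> \<le> y + (\<Sum>k<N. w k)" using w(2) by (simp add: sum_nonneg)
      finally show "sup (\<Sum>k<N. p k) (p N) \<le> y + (\<Sum>k<N. w k)" using Suc by simp
      have "(\<Sum>k<N. p k) \<le> (\<Sum>k<N. \<bar>u k\<bar>)" by (intro sum_mono) (simp add: p_def)
      then show "inf (\<Sum>k<N. p k) (p N) \<le> w N"
        unfolding w_def p_def by (simp add: le_infI1 le_infI2)
    qed
    finally show ?case by (simp add: add.assoc)
  qed (use y in simp)
  then have "(\<Sum>k<N. p k) \<le> y + suminf w" for N
    using sum_le_suminf_lattice [OF w] add_left_mono order_trans by blast
  then have "summable p" by (rule positive_schur_summable [OF psp p])
  then have "order_convergent p 0 sequentially"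
    using p by (rule order_convergent_zero_if_summable)
  then show "order_convergent (\<lambda>i. inf \<bar>u i - 0\<bar> y) 0 sequentially"
    by (simp add: p_def [abs_def])
qed


section \<open>Weak convergence to zero and convex combinations\<close>

definition sublinear :: "('a::real_vector \<Rightarrow> real) \<Rightarrow> bool" where
  "sublinear p \<longleftrightarrow>
     (\<forall>x y. p (x + y) \<le> p x + p y) \<and> (\<forall>c x. 0 \<le> c \<longrightarrow> p (c *\<^sub>R x) \<le> c * p x)"

lemma
  assumes "sublinear p"
  shows sublinear_add: "p (x + y) \<le> p x + p y"
    and sublinear_scaleR_le: "0 \<le> c \<Longrightarrow> p (c *\<^sub>R x) \<le> c * p x"
    and sublinear_zero: "p 0 = 0"
    and sublinear_minus: "- p (- x) \<le> p x"
proof -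
  show add: "p (x + y) \<le> p x + p y" for x y
    using assms by (auto simp: sublinear_def)
  show scale: "0 \<le> c \<Longrightarrow> p (c *\<^sub>R x) \<le> c * p x" for c x
    using assms by (auto simp: sublinear_def)
  show zero: "p 0 = 0"
    using add [of 0 0] scale [of 0 0] by simp
  show "- p (- x) \<le> p x"
    using add [of x "- x"] zero by simp
qed

text \<open>The inequality in \<open>sublinear\<close> for the scalar \<open>inverse c\<close> gives
  the reverse inequality, so it amounts to positive homogeneity.\<close>

lemma sublinear_scaleR:
  assumes "sublinear p" "0 \<le> c"
  shows "p (c *\<^sub>R x) = c * p x"
proof (cases "c = 0")
  case False
  with assms(2) have c: "c > 0" by simp
  have "p (inverse c *\<^sub>R (c *\<^sub>R x)) \<le> inverse c * p (c *\<^sub>R x)"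
    using c by (intro sublinear_scaleR_le [OF assms(1)]) simp
  then have "c * p x \<le> p (c *\<^sub>R x)"
    using c by (simp add: field_simps)
  with sublinear_scaleR_le [OF assms] show ?thesis by (intro antisym)
qed (simp add: sublinear_zero [OF assms(1)])

text \<open>Infima of sublinear functionals may fail to be subadditive. The assumption
  \<open>add\<close> lets one index \<open>k\<close> serve for two indices \<open>i\<close> and
  \<open>j\<close>; rays, chains and convex cones as index sets allow this.\<close>

lemma sublinear_INF:
  assumes "I \<noteq> {}"
    and bdd: "\<And>x. bdd_below ((\<lambda>i. F i x) ` I)"
    and add: "\<And>i j x y. i \<in> I \<Longrightarrow> j \<in> I \<Longrightarrow> \<exists>k\<in>I. F k (x + y) \<le> F i x + F j y"
    and scale: "\<And>i c x. i \<in> I \<Longrightarrow> 0 \<le> c \<Longrightarrow> \<exists>j\<in>I. F j (c *\<^sub>R x) \<le> c * F i x"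
  shows "sublinear (\<lambda>x. INF i\<in>I. F i x :: real)"
  unfolding sublinear_def
proof (intro conjI allI impI)
  fix x y
  have *: "(INF i\<in>I. F i (x + y)) \<le> F i x + F j y" if "i \<in> I" "j \<in> I" for i j
    using add [OF that] cINF_lower [OF bdd] order_trans by metis
  have "(INF i\<in>I. F i (x + y)) - F j y \<le> (INF i\<in>I. F i x)" if "j \<in> I" for j
    using * [OF _ that] by (intro cINF_greatest \<open>I \<noteq> {}\<close>) (simp add: diff_le_eq)
  then have "(INF i\<in>I. F i (x + y)) - (INF i\<in>I. F i x) \<le> (INF i\<in>I. F i y)"
    by (intro cINF_greatest \<open>I \<noteq> {}\<close>) (simp add: algebra_simps)
  then show "(INF i\<in>I. F i (x + y)) \<le> (INF i\<in>I. F i x) + (INF i\<in>I. F i y)" by simp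
next
  fix c :: real and x assume c: "0 \<le> c"
  have *: "(INF i\<in>I. F i (c *\<^sub>R x)) \<le> c * F i x" if "i \<in> I" for i
    using scale [OF that c] cINF_lower [OF bdd] order_trans by metis
  show "(INF i\<in>I. F i (c *\<^sub>R x)) \<le> c * (INF i\<in>I. F i x)"
  proof (cases "c = 0")
    case True
    then show ?thesis using * \<open>I \<noteq> {}\<close> by auto
  next
    case False
    with c have "c > 0" by simp
    then have "(INF i\<in>I. F i (c *\<^sub>R x)) / c \<le> (INF i\<in>I. F i x)"
      using * by (intro cINF_greatest \<open>I \<noteq> {}\<close>) (simp add: divide_le_eq mult.commute)
    with \<open>c > 0\<close> show ?thesis by (simp add: divide_le_eq mult.commute)
  qed
qed

text \<open>For fixed \<open>y\<close>, the infimum over \<open>t \<ge> 0\<close> of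
  \<open>m (z + t *\<^sub>R y) - t * m y\<close> is sublinear in \<open>z\<close> and, by
  \<open>t = 0\<close>, below \<open>m\<close>. Minimality makes it equal to \<open>m\<close>, and
  \<open>t = 1\<close> then gives superadditivity.\<close>

lemma minimal_sublinear_imp_linear:
  assumes m: "sublinear m"
    and min: "\<And>q. sublinear q \<Longrightarrow> (\<And>x. q x \<le> m x) \<Longrightarrow> q = m"
  shows "linear m"
proof -
  have super: "m x + m y \<le> m (x + y)" for x y
  proof -
    let ?F = "\<lambda>t z. m (z + t *\<^sub>R y) - t * m y"
    have bdd: "bdd_below ((\<lambda>t. ?F t z) ` {0..})" for z
    proof (rule bdd_belowI2)
      fix t :: real assume "t \<in> {0..}"
      then have "t * m y = m ((z + t *\<^sub>R y) + (- z))"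
        by (simp add: sublinear_scaleR [OF m])
      also have "\<dots> \<le> m (z + t *\<^sub>R y) + m (- z)" by (rule sublinear_add [OF m])
      finally show "- m (- z) \<le> ?F t z" by simp
    qed
    have "sublinear (\<lambda>z. INF t\<in>{0..}. ?F t z)"
    proof (rule sublinear_INF [OF _ bdd])
      fix s t :: real and u v assume "s \<in> {0..}" "t \<in> {0..}"
      moreover have "?F (s + t) (u + v) \<le> ?F s u + ?F t v"
        using sublinear_add [OF m, of "u + s *\<^sub>R y" "v + t *\<^sub>R y"] by (simp add: algebra_simps)
      ultimately show "\<exists>k\<in>{0..}. ?F k (u + v) \<le> ?F s u + ?F t v"
        by (intro bexI [of _ "s + t"]) auto
    next
      fix t c :: real and u assume "t \<in> {0..}" "0 \<le> c"
      moreover have "?F (c * t) (c *\<^sub>R u) \<le> c * ?F t u"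
        using sublinear_scaleR_le [OF m \<open>0 \<le> c\<close>, of "u + t *\<^sub>R y"] by (simp add: algebra_simps)
      ultimately show "\<exists>j\<in>{0..}. ?F j (c *\<^sub>R u) \<le> c * ?F t u"
        by (intro bexI [of _ "c * t"]) auto
    qed simp
    moreover have "(INF t\<in>{0..}. ?F t z) \<le> m z" for z
      using cINF_lower [OF bdd [of z], of 0] by simp
    ultimately have "(\<lambda>z. INF t\<in>{0..}. ?F t z) = m" by (rule min)
    then have "m x = (INF t\<in>{0..}. ?F t x)" by (rule fun_cong [symmetric])
    also have "\<dots> \<le> ?F 1 x" using cINF_lower [OF bdd [of x], of 1] by simp
    finally show ?thesis by simp
  qed
  have add: "m (x + y) = m x + m y" for x y
    using sublinear_add [OF m] super by (intro antisym)
  have minus: "m (- x) = - m x" for x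
    using add [of x "- x"] sublinear_zero [OF m] by simp
  show ?thesis
  proof (rule linearI)
    show "m (c *\<^sub>R x) = c *\<^sub>R m x" for c x
    proof (cases "0 \<le> c")
      case False
      then show ?thesis using sublinear_scaleR [OF m, of "- c" x] minus by simp
    qed (simp add: sublinear_scaleR [OF m])
  qed (rule add)
qed

text \<open>Zorn's lemma yields a minimal sublinear functional below \<open>p\<close>, which is
  linear. The pointwise infimum of a chain is finite, being at least
  \<open>- p (- x)\<close>.\<close>

lemma sublinear_dominates_linear:
  fixes p :: "'a::real_vector \<Rightarrow> real"
  assumes p: "sublinear p"
  obtains g where "linear g" "\<And>x. g x \<le> p x"
proof -
  define A where "A = {q. sublinear q \<and> q \<le> p}"
  have "\<exists>m\<in>A. \<forall>q\<in>A. q \<le> m \<longrightarrow> q = m"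
  proof (rule predicate_Zorn)
    \<comment> \<open>The order is reversed so that the maximal element is a minimal
      functional.\<close>
    show "partial_order_on A (relation_of (\<lambda>q q'. q' \<le> q) A)"
      by (rule partial_order_on_relation_ofI) auto
  next
    fix C assume C: "C \<in> Chains (relation_of (\<lambda>q q'. q' \<le> q) A)"
    show "\<exists>u\<in>A. \<forall>q\<in>C. u \<le> q"
    proof (cases "C = {}")
      case True
      then show ?thesis using p by (auto simp: A_def)
    next
      case False
      have CA: "sublinear q" "q x \<le> p x" if "q \<in> C" for q x
        using that C by (auto simp: Chains_def relation_of_def A_def le_fun_def)
      have chain: "q \<le> q' \<or> q' \<le> q" if "q \<in> C" "q' \<in> C" for q q'
        using that C by (auto simp: Chains_def relation_of_def)
      have bdd: "bdd_below ((\<lambda>q. q x) ` C)" for x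
      proof (rule bdd_belowI2)
        fix q assume "q \<in> C"
        then show "- p (- x) \<le> q x"
          using sublinear_minus [OF CA(1), of q x] CA(2) [of q "- x"] by linarith
      qed
      let ?u = "\<lambda>x. INF q\<in>C. q x"
      have lower: "?u x \<le> q x" if "q \<in> C" for q x
        by (rule cINF_lower [OF bdd that])
      have "sublinear ?u"
      proof (rule sublinear_INF [OF False bdd])
        fix q q' x y assume q: "q \<in> C" "q' \<in> C"
        from chain [OF this] show "\<exists>k\<in>C. k (x + y) \<le> q x + q' y"
        proof
          assume "q \<le> q'"
          then have "q (x + y) \<le> q x + q' y"
            using sublinear_add [OF CA(1) [OF q(1)], of x y] by (smt (verit) le_funD)
          with q show ?thesis by blast
        next
          assume "q' \<le> q"
          then have "q' (x + y) \<le> q x + q' y"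
            using sublinear_add [OF CA(1) [OF q(2)], of x y] by (smt (verit) le_funD)
          with q show ?thesis by blast
        qed
      qed (use CA(1) sublinear_scaleR_le in blast)
      moreover have "?u x \<le> p x" for x
        using False lower CA(2) order_trans by blast
      ultimately have "?u \<in> A" by (simp add: A_def le_fun_def)
      with lower show ?thesis by (intro bexI [of _ ?u]) (auto simp: le_fun_def)
    qed
  qed
  then obtain m where m: "sublinear m" "m \<le> p" and min: "\<And>q. q \<in> A \<Longrightarrow> q \<le> m \<Longrightarrow> q = m"
    by (auto simp: A_def)
  have "linear m"
  proof (rule minimal_sublinear_imp_linear [OF m(1)])
    fix q assume "sublinear q" "\<And>x. q x \<le> m x"
    with m(2) show "q = m"
      by (intro min) (auto simp: A_def le_fun_def intro: order_trans)
  qed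
  with m(2) show ?thesis by (intro that) (auto simp: le_fun_def)
qed

text \<open>Let \<open>C\<close> be the cone of pairs of a positive combination and its total
  weight. The infimum of \<open>norm (v + s) - c * t\<close> over \<open>(s, t)\<close> in
  \<open>C\<close> is sublinear in \<open>v\<close>. A linear \<open>g\<close> below it is bounded
  by the norm, through the pair \<open>(0, 0)\<close>, and at least \<open>c\<close> on each
  \<open>x k\<close>, through the pair \<open>(x k, 1)\<close>.\<close>

lemma not_weakly_null_if_combinations_bounded_below:
  fixes x :: "nat \<Rightarrow> 'a::real_normed_vector"
  assumes "c > 0"
    and bound: "\<And>a N. (\<And>k. 0 \<le> a k) \<Longrightarrow> c * (\<Sum>k<N. a k) \<le> norm (\<Sum>k<N. a k *\<^sub>R x k)"
  shows "\<not> weakly_null x"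
proof
  \<comment> \<open>Vanishing coefficients from \<open>N\<close> on allow two combinations to be
    rewritten with a common length when they are added.\<close>
  define C where "C = {(\<Sum>k<N. a k *\<^sub>R x k, \<Sum>k<N. a k) | a N.
    (\<forall>k. 0 \<le> a k) \<and> (\<forall>k\<ge>N. a k = 0)}"
  have CI: "(s, t) \<in> C" if "\<And>k. 0 \<le> a k" "\<And>k. k \<ge> N \<Longrightarrow> a k = 0"
    "s = (\<Sum>k<N. a k *\<^sub>R x k)" "t = (\<Sum>k<N. a k)" for s t a N
    using that by (auto simp: C_def)
  have C0: "(0, 0) \<in> C" by (rule CI [of "\<lambda>_. 0" 0]) auto
  have C1: "(x k, 1) \<in> C" for k
    by (rule CI [of "\<lambda>j. if j = k then 1 else 0" "Suc k"]) (auto simp: if_distrib [of "\<lambda>r. r *\<^sub>R _"] cong: if_cong)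
  have Cadd: "(s + s', t + t') \<in> C" if C: "(s, t) \<in> C" "(s', t') \<in> C" for s s' t t'
  proof -
    from C(1) obtain a N where a: "\<And>k. 0 \<le> a k" "\<And>k. k \<ge> N \<Longrightarrow> a k = 0"
      "s = (\<Sum>k<N. a k *\<^sub>R x k)" "t = (\<Sum>k<N. a k)" by (auto simp: C_def)
    from C(2) obtain b M where b: "\<And>k. 0 \<le> b k" "\<And>k. k \<ge> M \<Longrightarrow> b k = 0"
      "s' = (\<Sum>k<M. b k *\<^sub>R x k)" "t' = (\<Sum>k<M. b k)" by (auto simp: C_def)
    have "s = (\<Sum>k<N+M. a k *\<^sub>R x k)" "t = (\<Sum>k<N+M. a k)"
      unfolding a(3,4) using a(2) by (auto intro!: sum.mono_neutral_left intro: ccontr simp: not_less)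
    moreover have "s' = (\<Sum>k<N+M. b k *\<^sub>R x k)" "t' = (\<Sum>k<N+M. b k)"
      unfolding b(3,4) using b(2) by (auto intro!: sum.mono_neutral_left intro: ccontr simp: not_less)
    ultimately show ?thesis
      using a b by (intro CI [of "\<lambda>k. a k + b k" "N + M"]) (auto simp: sum.distrib scaleR_add_left)
  qed
  have Cscale: "(r *\<^sub>R s, r * t) \<in> C" if "(s, t) \<in> C" "0 \<le> r" for r s t
  proof -
    from that(1) obtain a N where a: "\<And>k. 0 \<le> a k" "\<And>k. k \<ge> N \<Longrightarrow> a k = 0"
      "s = (\<Sum>k<N. a k *\<^sub>R x k)" "t = (\<Sum>k<N. a k)" by (auto simp: C_def)
    then show ?thesis
      using that(2) by (intro CI [of "\<lambda>k. r * a k" N]) (auto simp: scaleR_sum_right sum_distrib_left)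
  qed
  have Cbound: "c * t \<le> norm s" if "(s, t) \<in> C" for s t
    using that bound by (auto simp: C_def)
  let ?F = "\<lambda>(s, t) v. norm (v + s) - c * t"
  have bdd: "bdd_below ((\<lambda>i. ?F i v) ` C)" for v
  \<comment> \<open>Here the hypothesis enters:
    \<open>c * t \<le> norm s \<le> norm (v + s) + norm v\<close>.\<close>
  proof (rule bdd_belowI2 [of _ "- norm v"])
    fix i assume "i \<in> C"
    then show "- norm v \<le> ?F i v"
      using Cbound norm_triangle_ineq2 [of "fst i" "- v"] by (cases i) (force simp: add.commute)
  qed
  let ?p = "\<lambda>v. INF i\<in>C. ?F i v"
  have lower: "?p v \<le> norm (v + s) - c * t" if "(s, t) \<in> C" for v s t
    using cINF_lower [OF bdd that] by simp
  have "sublinear ?p"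
  proof (rule sublinear_INF [OF _ bdd])
    fix i j u v assume "i \<in> C" "j \<in> C"
    moreover obtain s t s' t' where "i = (s, t)" "j = (s', t')" by fastforce
    moreover have "?F (s + s', t + t') (u + v) \<le> ?F (s, t) u + ?F (s', t') v"
      using norm_triangle_ineq [of "u + s" "v + s'"] by (simp add: algebra_simps)
    ultimately show "\<exists>k\<in>C. ?F k (u + v) \<le> ?F i u + ?F j v" using Cadd by blast
  next
    fix i and r :: real and v assume "i \<in> C" "0 \<le> r"
    moreover obtain s t where "i = (s, t)" by fastforce
    moreover have "?F (r *\<^sub>R s, r * t) (r *\<^sub>R v) \<le> r * ?F (s, t) v"
      using \<open>0 \<le> r\<close> by (simp add: scaleR_add_right [symmetric] algebra_simps del: scaleR_add_right)
    ultimately show "\<exists>j\<in>C. ?F j (r *\<^sub>R v) \<le> r * ?F i v" using Cscale by blast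
  qed (use C0 in blast)
  then obtain g where g: "linear g" "\<And>v. g v \<le> ?p v" by (rule sublinear_dominates_linear) blast
  have "g v \<le> norm v" for v using g(2) [of v] lower [OF C0, of v] by simp
  then have "\<bar>g v\<bar> \<le> norm v" for v
    using linear_neg [OF g(1), of v] by (metis abs_le_iff norm_minus_cancel)
  then have "bounded_linear g"
    using g(1) by (intro bounded_linear_intro [where K = 1]) (auto simp: linear_add linear_cmul)
  \<comment> \<open>At \<open>v = - x k\<close> the pair \<open>(x k, 1)\<close> makes the norm
    vanish and leaves \<open>- c\<close>.\<close>
  moreover have ge: "c \<le> g (x k)" for k
    using g(2) [of "- x k"] lower [OF C1, of "- x k" k] linear_neg [OF g(1), of "x k"] by simp
  moreover assume "weakly_null x"
  ultimately have "(\<lambda>k. g (x k)) \<longlonglongrightarrow> 0" by (simp add: weakly_null_def)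
  then have "c \<le> 0" using ge by (intro LIMSEQ_le_const) auto
  with \<open>c > 0\<close> show False by simp
qed

section \<open>Almost disjoint combinations, and weakly null sequences that are un-null\<close>

lemma abs_combination_ge:
  fixes x :: "nat \<Rightarrow> 'a::banach_lattice"
  assumes a: "\<And>k. k < N \<Longrightarrow> 0 \<le> a k" "\<And>k. k < N \<Longrightarrow> a k \<le> A"
  shows "(\<Sum>k<N. a k *\<^sub>R \<bar>x k\<bar>)
    \<le> \<bar>\<Sum>k<N. a k *\<^sub>R x k\<bar> + (2 * A) *\<^sub>R (\<Sum>k<N. inf \<bar>x k\<bar> (\<Sum>j<k. \<bar>x j\<bar>))"
  using a
proof (induction N)
  case (Suc N)
  \<comment> \<open>Splitting off the last term costs at most twice its overlap with
    \<open>?s\<close>. As all coefficients are at most \<open>A\<close>, that overlap is at most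
    \<open>A *\<^sub>R ?w N\<close>.\<close>
  let ?s = "\<Sum>k<N. a k *\<^sub>R x k" and ?w = "\<lambda>k. inf \<bar>x k\<bar> (\<Sum>j<k. \<bar>x j\<bar>)"
  have A: "0 \<le> a N" "a N \<le> A" using Suc.prems by auto
  then have "0 \<le> A" by simp
  have "\<bar>?s\<bar> \<le> (\<Sum>k<N. \<bar>a k *\<^sub>R x k\<bar>)" by (rule sum_abs)
  also have "\<dots> \<le> (\<Sum>k<N. A *\<^sub>R \<bar>x k\<bar>)"
    using Suc.prems by (intro sum_mono) (auto simp: abs_scaleR_nonneg intro!: scaleR_right_mono)
  also have "\<dots> = A *\<^sub>R (\<Sum>k<N. \<bar>x k\<bar>)" by (simp add: scaleR_sum_right)
  finally have s: "\<bar>?s\<bar> \<le> A *\<^sub>R (\<Sum>k<N. \<bar>x k\<bar>)" .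
  have "\<bar>a N *\<^sub>R x N\<bar> \<le> A *\<^sub>R \<bar>x N\<bar>"
    using A by (auto simp: abs_scaleR_nonneg intro!: scaleR_right_mono)
  with s have "inf \<bar>?s\<bar> \<bar>a N *\<^sub>R x N\<bar> \<le> inf (A *\<^sub>R \<bar>x N\<bar>) (A *\<^sub>R (\<Sum>k<N. \<bar>x k\<bar>))"
    by (simp add: le_infI1 le_infI2)
  then have "inf \<bar>?s\<bar> \<bar>a N *\<^sub>R x N\<bar> \<le> A *\<^sub>R ?w N" by (simp add: inf_scaleR \<open>0 \<le> A\<close>)
  then have inf: "2 *\<^sub>R inf \<bar>?s\<bar> \<bar>a N *\<^sub>R x N\<bar> \<le> 2 *\<^sub>R (A *\<^sub>R ?w N)"
    by (intro scaleR_left_mono) auto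
  have "\<bar>?s\<bar> + a N *\<^sub>R \<bar>x N\<bar> \<le> \<bar>?s + a N *\<^sub>R x N\<bar> + 2 *\<^sub>R inf \<bar>?s\<bar> \<bar>a N *\<^sub>R x N\<bar>"
    using abs_add_ge_minus_inf [of ?s "a N *\<^sub>R x N"] A(1) by (simp add: abs_scaleR_nonneg diff_le_eq)
  also have "\<dots> \<le> \<bar>?s + a N *\<^sub>R x N\<bar> + 2 *\<^sub>R (A *\<^sub>R ?w N)"
    by (intro add_left_mono inf)
  finally have step: "\<bar>?s\<bar> + a N *\<^sub>R \<bar>x N\<bar> \<le> \<bar>?s + a N *\<^sub>R x N\<bar> + (2 * A) *\<^sub>R ?w N"
    by simp
  have "(\<Sum>k<Suc N. a k *\<^sub>R \<bar>x k\<bar>) \<le> (\<bar>?s\<bar> + (2 * A) *\<^sub>R (\<Sum>k<N. ?w k)) + a N *\<^sub>R \<bar>x N\<bar>"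
    using Suc.IH Suc.prems by simp
  also have "\<dots> = (\<bar>?s\<bar> + a N *\<^sub>R \<bar>x N\<bar>) + (2 * A) *\<^sub>R (\<Sum>k<N. ?w k)" by (simp add: ac_simps)
  also have "\<dots> \<le> (\<bar>?s + a N *\<^sub>R x N\<bar> + (2 * A) *\<^sub>R ?w N) + (2 * A) *\<^sub>R (\<Sum>k<N. ?w k)"
    by (intro add_right_mono step)
  finally show ?case by (simp add: scaleR_add_right ac_simps)
qed simp

lemma not_LIMSEQ_zero_subseq:
  fixes a :: "nat \<Rightarrow> real"
  assumes "\<not> a \<longlonglongrightarrow> 0"
  obtains \<delta> \<sigma> and s :: "nat \<Rightarrow> nat" where "\<delta> > 0" "\<bar>\<sigma>\<bar> = 1" "strict_mono s" "\<And>n. \<delta> \<le> \<sigma> * a (s n)"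
proof -
  obtain \<delta> where \<delta>: "\<delta> > 0" "\<exists>\<^sub>F n in sequentially. \<delta> \<le> \<bar>a n\<bar>"
    using assms by (auto simp: tendsto_iff not_eventually not_less)
  then have "\<exists>\<^sub>F n in sequentially. \<delta> \<le> 1 * a n \<or> \<delta> \<le> - 1 * a n"
    by (elim frequently_elim1) auto
  \<comment> \<open>One of the two signs occurs infinitely often; \<sigma> is that sign.\<close>
  then obtain \<sigma> where \<sigma>: "\<bar>\<sigma>\<bar> = 1" "\<exists>\<^sub>F n in sequentially. \<delta> \<le> \<sigma> * a n"
    unfolding frequently_disj_iff by (metis abs_1 abs_minus_cancel)
  then have "infinite {n. \<delta> \<le> \<sigma> * a n}"
    by (simp add: cofinite_eq_sequentially [symmetric] frequently_cofinite)
  then show ?thesis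
    using enumerate_in_set [of "{n. \<delta> \<le> \<sigma> * a n}"]
    by (intro that [OF \<delta>(1) \<sigma>(1) strict_mono_enumerate]) auto
qed

lemma weakly_null_subseq:
  "weakly_null x \<Longrightarrow> strict_mono r \<Longrightarrow> weakly_null (\<lambda>n. x (r n))"
  unfolding weakly_null_def
  by (auto intro: LIMSEQ_subseq_LIMSEQ [unfolded comp_def])

lemma un_convergent_subseq:
  "un_convergent x l sequentially \<Longrightarrow> strict_mono r \<Longrightarrow> un_convergent (\<lambda>n. x (r n)) l sequentially"
  unfolding un_convergent_def
  using LIMSEQ_subseq_LIMSEQ [unfolded comp_def] by fast

lemma weakly_null_un_null_imp_norm_null:
  fixes x :: "nat \<Rightarrow> 'a::banach_lattice"
  assumes psp: "positive_schur TYPE('a)"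
    and weak: "weakly_null x" and un: "un_convergent x 0 sequentially"
  shows "(\<lambda>n. norm (x n)) \<longlonglongrightarrow> 0"
proof (rule ccontr)
  assume "\<not> ?thesis"
  then obtain \<epsilon> \<sigma> and s :: "nat \<Rightarrow> nat" where \<epsilon>: "\<epsilon> > 0" "\<bar>\<sigma>\<bar> = 1" "strict_mono s" "\<And>n. \<epsilon> \<le> \<sigma> * norm (x (s n))"
    by (rule not_LIMSEQ_zero_subseq) (rule that)
  have "\<epsilon> \<le> norm (x (s n))" for n
    using \<epsilon>(2) \<epsilon>(4) [of n] abs_mult [of \<sigma> "norm (x (s n))"] abs_ge_self [of "\<sigma> * norm (x (s n))"] by simp
  then have "\<not> (\<lambda>n. norm \<bar>x (s n)\<bar>) \<longlonglongrightarrow> 0"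
    using \<epsilon>(1) LIMSEQ_le_const [of "\<lambda>n. norm (x (s n))" 0 \<epsilon>] by auto
  then have "\<not> weakly_null (\<lambda>n. \<bar>x (s n)\<bar>)"
    using psp unfolding positive_schur_def by (metis abs_ge_zero)
  then obtain f :: "'a \<Rightarrow> real" where f: "bounded_linear f" "\<not> (\<lambda>n. f \<bar>x (s n)\<bar>) \<longlonglongrightarrow> 0"
    by (auto simp: weakly_null_def)
  from f(2) obtain \<delta> \<tau> and q :: "nat \<Rightarrow> nat" where \<delta>: "\<delta> > 0" "\<bar>\<tau>\<bar> = 1" "strict_mono q" "\<And>n. \<delta> \<le> \<tau> * f \<bar>x (s (q n))\<bar>"
    by (rule not_LIMSEQ_zero_subseq) (rule that)
  obtain K where K: "K > 0" "\<And>v. norm (f v) \<le> norm v * K"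
    using bounded_linear.pos_bounded [OF f(1)] by blast
  \<comment> \<open>The functional bounds combinations of the moduli below by \<open>2 * c\<close>
    times the total weight. Half of this is reserved for the error of almost disjointness, leaving
    the factor \<open>c\<close>.\<close>
  define c where "c = \<delta> / (2 * K)"
  have c: "c > 0" "2 * c * K = \<delta>" using \<delta>(1) K(1) by (auto simp: c_def)
  have sq: "strict_mono (\<lambda>n. s (q n))" using \<epsilon>(3) \<delta>(3) by (simp add: strict_mono_def)
  \<comment> \<open>The tolerances sum to at most \<open>c / 2\<close>, so the error factor
    \<open>2 * A\<close> from \<open>abs_combination_ge\<close> costs no more than
    \<open>c * A\<close>.\<close>
  obtain r where r: "strict_mono r"
    and small: "\<And>k. norm (inf \<bar>x (s (q (r k)))\<bar> (\<Sum>j<k. \<bar>x (s (q (r j)))\<bar>)) < c / 2 * (1 / 2) ^ Suc k"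
    using un_null_almost_disjoint_subseq [OF un_convergent_subseq [OF un sq], of "\<lambda>k. c / 2 * (1 / 2) ^ Suc k"]
      c(1) by auto
  define z where "z k = x (s (q (r k)))" for k
  have "weakly_null z"
    unfolding z_def using weakly_null_subseq [OF weakly_null_subseq [OF weak sq] r] .
  moreover have "\<not> weakly_null z"
  proof (rule not_weakly_null_if_combinations_bounded_below [OF c(1)])
    fix a :: "nat \<Rightarrow> real" and N assume a: "\<And>k. 0 \<le> a k"
    \<comment> \<open>The total weight also bounds each single coefficient, as
      \<open>abs_combination_ge\<close> requires.\<close>
    define A where "A = (\<Sum>k<N. a k)"
    have A: "0 \<le> A" "\<And>k. k < N \<Longrightarrow> a k \<le> A"
      using a by (auto simp: A_def sum_nonneg intro: member_le_sum)
    let ?S = "\<Sum>k<N. a k *\<^sub>R z k" and ?w = "\<lambda>k. inf \<bar>z k\<bar> (\<Sum>j<k. \<bar>z j\<bar>)"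
    have lin: "linear f" using f(1) by (rule bounded_linear.linear)
    have "\<delta> * A \<le> \<tau> * f (\<Sum>k<N. a k *\<^sub>R \<bar>z k\<bar>)"
    proof -
      have "\<delta> * A \<le> (\<Sum>k<N. a k * (\<tau> * f \<bar>z k\<bar>))"
        unfolding A_def sum_distrib_left mult.commute [of \<delta>]
        using \<delta>(4) a by (intro sum_mono mult_left_mono) (auto simp: z_def)
      then show ?thesis
        by (simp add: linear_sum [OF lin] linear_cmul [OF lin] sum_distrib_left mult.left_commute)
    qed
    also have "\<dots> \<le> \<bar>\<tau> * f (\<Sum>k<N. a k *\<^sub>R \<bar>z k\<bar>)\<bar>" by (rule abs_ge_self)
    also have "\<dots> \<le> norm (\<Sum>k<N. a k *\<^sub>R \<bar>z k\<bar>) * K"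
      using K(2) [of "\<Sum>k<N. a k *\<^sub>R \<bar>z k\<bar>"] by (simp add: abs_mult \<delta>(2))
    finally have "2 * c * A \<le> norm (\<Sum>k<N. a k *\<^sub>R \<bar>z k\<bar>)"
      using K(1) c(2) by (metis mult.assoc mult.commute mult_le_cancel_right_pos)
    also have "\<dots> \<le> norm (\<bar>?S\<bar> + (2 * A) *\<^sub>R (\<Sum>k<N. ?w k))"
      using a A(2) by (intro norm_mono_nonneg abs_combination_ge sum_nonneg) (auto simp: scaleR_nonneg_nonneg)
    also have "\<dots> \<le> norm ?S + 2 * A * norm (\<Sum>k<N. ?w k)"
      using A(1) by (intro norm_triangle_le) simp
    also have "norm (\<Sum>k<N. ?w k) \<le> c / 2"
    proof -
      have "norm (\<Sum>k<N. ?w k) \<le> (\<Sum>k<N. c / 2 * (1 / 2) ^ Suc k)"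
        using small by (intro sum_norm_le) (auto simp: z_def intro: less_imp_le)
      also have "\<dots> = c / 2 * (\<Sum>k<N. (1 / 2) ^ Suc k)" by (simp add: sum_distrib_left)
      also have "(\<Sum>k<N. (1 / 2) ^ Suc k) = 1 - (1 / 2 :: real) ^ N"
        by (induction N) auto
      also have "c / 2 * (1 - (1 / 2) ^ N) \<le> c / 2 * 1"
        using c(1) by (intro mult_left_mono) auto
      finally show ?thesis by simp
    qed
    then have "norm ?S + 2 * A * norm (\<Sum>k<N. ?w k) \<le> norm ?S + 2 * A * (c / 2)"
      using A(1) by (intro add_left_mono mult_left_mono) auto
    finally show "c * (\<Sum>k<N. a k) \<le> norm ?S" by (simp add: A_def [symmetric] mult.commute)
  qed
  ultimately show False by blast
qed

section \<open>Equivalence of the two demi Dunford-Pettis properties\<close>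

theorem proposition3p5:
  fixes T :: "'a::banach_lattice \<Rightarrow> 'a"
  assumes "positive_schur TYPE('a)"
    and "bounded_linear T"
  shows "uo_demi_Dunford_Pettis T \<longleftrightarrow> un_demi_Dunford_Pettis T"
proof
  assume uo: "uo_demi_Dunford_Pettis T"
  show "un_demi_Dunford_Pettis T"
    unfolding un_demi_Dunford_Pettis_def un_convergent_def [of _ 0]
  proof (intro allI impI, rule ccontr, elim conjE)
    fix x :: "nat \<Rightarrow> 'a" and y :: 'a
    assume weak: "weakly_null x"
      and "\<forall>y\<ge>0. (\<lambda>n. norm (inf \<bar>x n - T (x n) - 0\<bar> y)) \<longlonglongrightarrow> 0" and y: "0 \<le> y"
      and not_null: "\<not> (\<lambda>n. norm (inf \<bar>x n - 0\<bar> y)) \<longlonglongrightarrow> 0"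
    then have un: "un_convergent (\<lambda>n. x n - T (x n)) 0 sequentially"
      by (simp add: un_convergent_def)
    obtain \<epsilon> \<sigma> and s :: "nat \<Rightarrow> nat" where \<epsilon>: "\<epsilon> > 0" "\<bar>\<sigma>\<bar> = 1" "strict_mono s"
      "\<And>n. \<epsilon> \<le> \<sigma> * norm (inf \<bar>x (s n) - 0\<bar> y)"
      by (rule not_LIMSEQ_zero_subseq [OF not_null]) (rule that)
    \<comment> \<open>The truncation by \<open>y\<close> lies below the modulus, so \<open>x\<close>
      itself stays away from 0 in norm along \<open>s\<close>; a norm null subsequence of it will be
      absurd.\<close>
    have large: "\<epsilon> \<le> norm (x (s n))" for n
    proof -
      have "\<epsilon> \<le> \<bar>\<sigma> * norm (inf \<bar>x (s n)\<bar> y)\<bar>" using \<epsilon>(4) [of n] by simp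
      also have "\<dots> = norm (inf \<bar>x (s n)\<bar> y)" by (simp add: abs_mult \<epsilon>(2))
      also have "\<dots> \<le> norm \<bar>x (s n)\<bar>" using y by (intro norm_mono_nonneg) auto
      finally show ?thesis by simp
    qed
    let ?z = "\<lambda>n. x (s n) - T (x (s n))"
    \<comment> \<open>The almost disjoint subsequence is taken from the differences
      \<open>x n - T (x n)\<close>: a subsequence of these is uo-null, so the property of
      \<open>T\<close> applies along it.\<close>
    obtain r where r: "strict_mono r"
      and small: "\<And>k. norm (inf \<bar>?z (r k)\<bar> (\<Sum>j<k. \<bar>?z (r j)\<bar>)) < (1 / 2) ^ k"
      using un_null_almost_disjoint_subseq [OF un_convergent_subseq [OF un \<epsilon>(3)], of "\<lambda>k. (1 / 2) ^ k"]
      by auto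
    have "summable (\<lambda>k. norm (inf \<bar>?z (r k)\<bar> (\<Sum>j<k. \<bar>?z (r j)\<bar>)))"
      by (rule summable_comparison_test' [OF summable_geometric [of "1 / 2 :: real"], of 0])
        (use small in \<open>auto intro: less_imp_le\<close>)
    then have "uo_convergent (\<lambda>n. ?z (r n)) 0 sequentially"
      by (rule almost_disjoint_imp_uo_null [OF assms(1)])
    moreover have "weakly_null (\<lambda>n. x (s (r n)))"
      using weakly_null_subseq [OF weakly_null_subseq [OF weak \<epsilon>(3)] r] .
    ultimately have "(\<lambda>n. norm (x (s (r n)))) \<longlonglongrightarrow> 0"
      using uo unfolding uo_demi_Dunford_Pettis_def by blast
    then have "\<epsilon> \<le> 0" using large by (intro LIMSEQ_le_const) auto
    with \<epsilon>(1) show False by simp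
  qed
next
  assume un: "un_demi_Dunford_Pettis T"
  show "uo_demi_Dunford_Pettis T"
    unfolding uo_demi_Dunford_Pettis_def
  proof (intro allI impI, elim conjE)
    fix x :: "nat \<Rightarrow> 'a"
    assume weak: "weakly_null x" and "uo_convergent (\<lambda>n. x n - T (x n)) 0 sequentially"
    \<comment> \<open>Order continuity of the norm makes the differences un-null; the un-property
      yields only un-convergence of \<open>x\<close>, which weak nullity then upgrades to norm
      convergence.\<close>
    then have "un_convergent x 0 sequentially"
      using un uo_convergent_imp_un_convergent [OF assms(1)]
      unfolding un_demi_Dunford_Pettis_def by blast
    then show "(\<lambda>n. norm (x n)) \<longlonglongrightarrow> 0"
      by (rule weakly_null_un_null_imp_norm_null [OF assms(1) weak])
  qed
qed

end
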